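(* Let $\mathcal{H}$ be a real reproducing kernel Hilbert space on some domain $\Omega$. Let $\psi$ be a continuous function on $\Omega$. Let $K\subseteq\Omega$ be compact. Then the aesthetic margin $\iota_{\mathrm{topiary}(K)}$ of $\mathrm{topiary}(K)$ is $0$ on the support of $\mathrm{topiary}(K)$ and nonpositive on $K$. Writing $\mu=\mathrm{topiary}(K)$, the number $r_K=\int(\psi(t)-\mu(t))\,d\mu(t)$ is called the available topiaric rate. The topiaric index of $K$, denoted $\mathrm{Topiary}(K)$, is defined to be the preimage of zero for the aesthetic margin of the topiary, that is, $\mathrm{Topiary}(K)=\iota_{\mathrm{topiary}(K)}^{-1}(0)$. Any set arising as the topiaric index of some compact set is called a topiaric index.
   Context: A real reproducing kernel Hilbert space $\mathcal{H}$ on a domain $\Omega$ is a Hilbert space of real-valued functions on $\Omega$ such that point evaluation at each $\alpha\in\Omega$ is a bounded linear functional; $k_\alpha\in\mathcal{H}$ denotes the element with $f(\alpha)=\langle f,k_\alpha\rangle$ for all $f\in\mathcal{H}$. A distribution is a compactly supported probability measure on $\Omega$. To a distribution $\mu$ one associates, via the Riesz representation theorem applied to the functional given by integration against $\mu$, the embedded distribution in $\mathcal{H}$, also denoted $\mu$, so that $\int f\,d\mu=\langle f,\mu\rangle$ for $f\in\mathcal{H}$. Thus $\|\mu\|$ is the norm of the embedded distribution in $\mathcal{H}$, and $\mu(x)=\langle\mu,k_x\rangle$ is its value at $x$. The aesthetic objective is $\mathfrak{O}(\mu)=\int\psi\,d\mu-\|\mu\|^2/2$. The topiary of $K$ with respect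 to $\psi$ over $\mathcal{H}$, denoted $\mathrm{topiary}(K)$, is the maximizer of $\mathfrak{O}$ over all distributions on $K$; it may not be unique as a measure, but the embedded measure is unique. The aesthetic margin of a distribution $\mu$ is the function $$\iota_\mu=\psi-\mu-\int(\psi(t)-\mu(t))\,d\mu(t).$$
   Formalization: All functions in the Hilbert space are additionally assumed continuous on Ω; without this the claim fails: on [0,1] let H be spanned by a unit vector g with g=1/2 except g(p)=1, and ψ=1; Lebesgue measure is a topiary whose margin at p is −1/4. *)

theory Defs
  imports "HOL-Probability.Probability"
begin

(* A Hilbert space of functions on \<Omega> is given as an arbitrary real Hilbert space 'h
   (sort {real_inner, complete_space}) together with a map val realising its elements as functions:
   val f x is the value f(x). Linearity and injectivity of val say that 'h is a linear space of
   functions on \<Omega>, with the pointwise operations; values outside \<Omega> are irrelevant. *)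
locale rkhs =
  fixes \<Omega> :: "'a set"
    and val :: "'h::{real_inner, complete_space} \<Rightarrow> 'a \<Rightarrow> real"
  assumes val_bounded_linear: "x \<in> \<Omega> \<Longrightarrow> bounded_linear (\<lambda>f. val f x)"
    and val_inject: "(\<And>x. x \<in> \<Omega> \<Longrightarrow> val f x = val g x) \<Longrightarrow> f = g"

(* Measures live on the Borel sets of the subspace \<Omega>. "Supported in C" means concentrated on C;
   for compact C in a second countable space this is the same as
   measure_support \<mu> \<subseteq> C. *)
definition distribution :: "'a::t2_space set \<Rightarrow> 'a measure \<Rightarrow> bool" where
  "distribution \<Omega> \<mu> \<longleftrightarrow>
     prob_space \<mu> \<and> sets \<mu> = sets (restrict_space borel \<Omega>) \<and>
     (\<exists>C. compact C \<and> C \<subseteq> \<Omega> \<and> (AE x in \<mu>. x \<in> C))"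

definition distribution_on :: "'a::t2_space set \<Rightarrow> 'a set \<Rightarrow> 'a measure \<Rightarrow> bool" where
  "distribution_on \<Omega> K \<mu> \<longleftrightarrow> distribution \<Omega> \<mu> \<and> (AE x in \<mu>. x \<in> K)"

definition measure_support :: "'a::topological_space measure \<Rightarrow> 'a set" where
  "measure_support \<mu> =
     {x \<in> space \<mu>. \<forall>U. open U \<longrightarrow> x \<in> U \<longrightarrow> emeasure \<mu> (U \<inter> space \<mu>) > 0}"

(* The Riesz representative of integration against \<mu>. Its value \<mu>(x) = <\<mu>, k_x> at x is
   val (embedded val \<mu>) x. *)
definition embedded :: "('h::{real_inner, complete_space} \<Rightarrow> 'a \<Rightarrow> real) \<Rightarrow> 'a measure \<Rightarrow> 'h" where
  "embedded val \<mu> = (THE m. \<forall>f. (\<integral>x. val f x \<partial>\<mu>) = f \<bullet> m)"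

definition aesthetic_objective ::
  "('h::{real_inner, complete_space} \<Rightarrow> 'a \<Rightarrow> real) \<Rightarrow> ('a \<Rightarrow> real) \<Rightarrow> 'a measure \<Rightarrow> real" where
  "aesthetic_objective val \<psi> \<mu> = (\<integral>x. \<psi> x \<partial>\<mu>) - (norm (embedded val \<mu>))\<^sup>2 / 2"

(* The maximizer need not be unique as a measure, so being a topiary is a predicate on measures. *)
definition is_topiary ::
  "'a::t2_space set \<Rightarrow> ('h::{real_inner, complete_space} \<Rightarrow> 'a \<Rightarrow> real) \<Rightarrow> ('a \<Rightarrow> real) \<Rightarrow>
     'a set \<Rightarrow> 'a measure \<Rightarrow> bool" where
  "is_topiary \<Omega> val \<psi> K \<mu> \<longleftrightarrow> is_arg_max (aesthetic_objective val \<psi>) (distribution_on \<Omega> K) \<mu>"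

(* For a topiary \<mu> of K this is the available topiaric rate r_K. *)
definition topiaric_rate ::
  "('h::{real_inner, complete_space} \<Rightarrow> 'a \<Rightarrow> real) \<Rightarrow> ('a \<Rightarrow> real) \<Rightarrow> 'a measure \<Rightarrow> real" where
  "topiaric_rate val \<psi> \<mu> = (\<integral>t. \<psi> t - val (embedded val \<mu>) t \<partial>\<mu>)"

definition aesthetic_margin ::
  "('h::{real_inner, complete_space} \<Rightarrow> 'a \<Rightarrow> real) \<Rightarrow> ('a \<Rightarrow> real) \<Rightarrow> 'a measure \<Rightarrow> 'a \<Rightarrow> real" where
  "aesthetic_margin val \<psi> \<mu> x = \<psi> x - val (embedded val \<mu>) x - topiaric_rate val \<psi> \<mu>"

(* For a topiary \<mu> of K this is Topiary(K). *)
definition topiaric_index ::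
  "'a set \<Rightarrow> ('h::{real_inner, complete_space} \<Rightarrow> 'a \<Rightarrow> real) \<Rightarrow> ('a \<Rightarrow> real) \<Rightarrow>
     'a measure \<Rightarrow> 'a set" where
  "topiaric_index \<Omega> val \<psi> \<mu> = {x \<in> \<Omega>. aesthetic_margin val \<psi> \<mu> x = 0}"

definition is_topiaric_index ::
  "'a::t2_space set \<Rightarrow> ('h::{real_inner, complete_space} \<Rightarrow> 'a \<Rightarrow> real) \<Rightarrow> ('a \<Rightarrow> real) \<Rightarrow>
     'a set \<Rightarrow> bool" where
  "is_topiaric_index \<Omega> val \<psi> S \<longleftrightarrow>
     (\<exists>K \<mu>. compact K \<and> K \<subseteq> \<Omega> \<and> is_topiary \<Omega> val \<psi> K \<mu> \<and> S = topiaric_index \<Omega> val \<psi> \<mu>)"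

end

(* Moving mass t of the topiary \<mu> to a point x of K changes the aesthetic objective by
   t * \<iota>(x) + O(t^2), where \<iota> is the aesthetic margin, so maximality gives \<iota> \<le> 0 on K.
   Since \<iota> has \<mu>-mean zero, it vanishes \<mu>-almost everywhere, and by continuity on the whole
   support. That \<mu> embeds at all rests on the uniform boundedness principle: every function
   in the space is bounded on a compact set carrying \<mu>, so the point evaluations
   there are uniformly bounded. *)

theory Submission imports Defs begin

section \<open>Bounded functionals on complete spaces\<close>

lemma uniform_boundedness_principle:
  fixes T :: "'i \<Rightarrow> 'h::{real_normed_vector, complete_space} \<Rightarrow> 'b::real_normed_vector"
  assumes lin: "\<And>i. i \<in> I \<Longrightarrow> bounded_linear (T i)"
    and bdd: "\<And>f. bounded ((\<lambda>i. T i f) ` I)"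
  shows "\<exists>B. \<forall>i\<in>I. \<forall>f. norm (T i f) \<le> B * norm f"
proof -
  \<comment> \<open>Baire category argument: countably many closed sets exhaust a complete space, so
    one of them contains a ball.\<close>
  define F where "F n = {f. \<forall>i\<in>I. norm (T i f) \<le> real n}" for n
  have closedF: "closed (F n)" for n
  proof -
    have "closed {f. norm (T i f) \<le> real n}" if "i \<in> I" for i
      using lin[OF that]
      by (intro closed_Collect_le continuous_intros)
        (auto intro: linear_continuous_on)
    moreover have "F n = (\<Inter>i\<in>I. {f. norm (T i f) \<le> real n})"
      by (auto simp: F_def)
    ultimately show ?thesis by auto
  qed
  have cover: "\<Union> (range F) = UNIV"
  proof -
    have "\<exists>n. f \<in> F n" for f
    proof -
      obtain b where b: "\<And>i. i \<in> I \<Longrightarrow> norm (T i f) \<le> b"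
        using bdd[of f] by (auto simp: bounded_iff)
      obtain n where "b \<le> real n" using real_arch_simple by blast
      then show ?thesis unfolding F_def using b order_trans by blast
    qed
    then show ?thesis by blast
  qed
  have "\<exists>n. interior (F n) \<noteq> {}"
  proof (rule ccontr)
    assume "\<not> ?thesis"
    then have empty: "interior (F n) = {}" for n by blast
    \<comment> \<open>The Baire theorem speaks of abstract metric spaces, so completeness of the
      type is restated in that form.\<close>
    have "Met_TC.mcomplete TYPE('h)"
      using Cauchy_convergent
      by (auto simp: Met_TC.mcomplete_def convergent_def simp del: mcomplete_iff_complete)
    then have "Met_TC.mtopology interior_of \<Union> (range F) = {}"
      using closedF empty
      by (intro Met_TC.metric_Baire_category_alt) auto
    then show False using cover by simp
  qed
  then obtain n f0 where "f0 \<in> interior (F n)" by blast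
  then obtain r where r: "r > 0" "cball f0 r \<subseteq> F n"
    by (meson mem_interior_cball)
  \<comment> \<open>The ball is centred at \<open>f0\<close>; writing \<open>g\<close> as a
    difference of two of its points moves it to the origin and doubles the bound.\<close>
  have small: "norm (T i g) \<le> 2 * real n" if "i \<in> I" "norm g \<le> r" for i g
  proof -
    have "f0 + g \<in> F n" "f0 \<in> F n"
      using r that by (auto simp: dist_norm subset_iff)
    then have "norm (T i (f0 + g)) \<le> n" "norm (T i f0) \<le> n"
      using that by (auto simp: F_def)
    moreover have "T i g = T i (f0 + g) - T i f0"
      using lin[OF that(1)] by (simp add: linear_simps)
    ultimately show ?thesis
      using norm_triangle_ineq4[of "T i (f0 + g)" "T i f0"] by simp
  qed
  \<comment> \<open>By homogeneity, rescaling \<open>f\<close> to norm \<open>r\<close> turns the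
    bound on the ball into one proportional to the norm.\<close>
  have "norm (T i f) \<le> (2 * real n / r) * norm f" if i: "i \<in> I" for i f
  proof (cases "f = 0")
    case True
    then show ?thesis using lin[OF i] by (simp add: linear_simps)
  next
    case False
    have "norm (T i ((r / norm f) *\<^sub>R f)) \<le> 2 * real n"
      using r False by (intro small i) auto
    moreover have "T i ((r / norm f) *\<^sub>R f) = (r / norm f) *\<^sub>R T i f"
      using lin[OF i] by (simp add: linear_simps)
    ultimately show ?thesis
      using r False by (simp add: field_simps)
  qed
  then show ?thesis by blast
qed

text \<open>Variational proof: the representative is the minimizer of half the squared norm minus
  \<phi>, a strictly convex functional whose first-order condition at m is the claimed
  identity.\<close>

lemma Riesz_representation:
  fixes \<phi> :: "'h::{real_inner, complete_space} \<Rightarrow> real"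
  assumes "bounded_linear \<phi>"
  shows "\<exists>m. \<forall>f. \<phi> f = f \<bullet> m"
proof -
  interpret bounded_linear \<phi> by fact
  define J where "J f = (norm f)\<^sup>2 / 2 - \<phi> f" for f
  obtain B where B: "\<And>f. \<bar>\<phi> f\<bar> \<le> norm f * B"
    using bounded by auto
  \<comment> \<open>Complete the square in \<open>norm f\<close>.\<close>
  have "- (B\<^sup>2 / 2) \<le> J f" for f
  proof -
    have "0 \<le> (norm f - B)\<^sup>2" by simp
    then show ?thesis
      using B[of f] by (simp add: J_def power2_diff abs_le_iff)
  qed
  then have bdd: "bdd_below (range J)" by (rule bdd_belowI2)
  define L where "L = Inf (range J)"
  have L: "L \<le> J f" for f unfolding L_def by (rule cINF_lower[OF bdd]) simp
  have "\<exists>f. J f < L + 1 / Suc n" for n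
    using cInf_lessD[of "range J" "L + 1 / Suc n"] by (auto simp: L_def)
  then obtain s where s: "\<And>n. J (s n) < L + 1 / Suc n" by metis
  \<comment> \<open>Parallelogram law; the linear terms cancel. Two near-minimizers are close
    together because their midpoint cannot go below the infimum.\<close>
  have par: "(norm (f - g))\<^sup>2 / 4 = J f + J g - 2 * J ((1/2) *\<^sub>R (f + g))" for f g
    by (simp add: J_def add scaleR power2_norm_eq_inner inner_add inner_diff inner_commute field_simps)
  have "Cauchy s"
  proof (rule CauchyI)
    fix e :: real assume "e > 0"
    \<comment> \<open>Each of the two terms exceeds \<open>L\<close> by less than this eighth, and
      \<open>par\<close> multiplies the total excess by 4.\<close>
    then obtain N where N: "1 / Suc N < e\<^sup>2 / 8"
      using reals_Archimedean[of "e\<^sup>2 / 8"] by (auto simp: inverse_eq_divide)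
    show "\<exists>N. \<forall>m\<ge>N. \<forall>n\<ge>N. norm (s m - s n) < e"
    proof (intro exI allI impI)
      fix m n assume mn: "m \<ge> N" "n \<ge> N"
      have "1 / Suc m \<le> 1 / Suc N" "1 / Suc n \<le> 1 / Suc N"
        using mn by (auto simp: frac_le)
      then have "(norm (s m - s n))\<^sup>2 < e\<^sup>2"
        using par[of "s m" "s n"] s[of m] s[of n] L[of "(1/2) *\<^sub>R (s m + s n)"] N by linarith
      then show "norm (s m - s n) < e"
        using \<open>e > 0\<close> power2_less_imp_less by fastforce
    qed
  qed
  then obtain m where m: "s \<longlonglongrightarrow> m"
    using Cauchy_convergent convergent_def by blast
  have "(\<lambda>n. J (s n)) \<longlonglongrightarrow> J m"
    unfolding J_def by (intro tendsto_intros m tendsto) simp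
  moreover have "(\<lambda>n. L + 1 / Suc n) \<longlonglongrightarrow> L"
    using tendsto_add[OF tendsto_const[of L] LIMSEQ_inverse_real_of_nat]
    by (simp add: inverse_eq_divide)
  ultimately have "J m \<le> L"
    using s by (intro LIMSEQ_le) (auto intro: less_imp_le)
  \<comment> \<open>Growth of \<open>J\<close> along the line through the minimizer in direction
    \<open>f\<close>: a quadratic in \<open>t\<close> that is never negative, so its linear
    coefficient must vanish.\<close>
  have min: "0 \<le> t * (f \<bullet> m - \<phi> f) + t\<^sup>2 * (norm f)\<^sup>2 / 2" for f t
  proof -
    have "(norm (m + t *\<^sub>R f))\<^sup>2 = (norm m)\<^sup>2 + 2 * t * (f \<bullet> m) + t\<^sup>2 * (norm f)\<^sup>2"
      unfolding power2_norm_eq_inner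
      by (simp add: inner_add inner_commute algebra_simps power2_eq_square)
    then have "J (m + t *\<^sub>R f) = J m + t * (f \<bullet> m - \<phi> f) + t\<^sup>2 * (norm f)\<^sup>2 / 2"
      by (simp add: J_def add scaleR algebra_simps)
    then show ?thesis
      using L[of "m + t *\<^sub>R f"] \<open>J m \<le> L\<close> by linarith
  qed
  have "\<phi> f = f \<bullet> m" for f
  proof -
    define a where "a = f \<bullet> m - \<phi> f"
    \<comment> \<open>The added 1 keeps the test value \<open>t = - a / q\<close> meaningful when
      \<open>f = 0\<close>; at that \<open>t\<close> the quadratic is at most
      \<open>- (a\<^sup>2 / (2 * q))\<close>.\<close>
    define q where "q = (norm f)\<^sup>2 + 1"
    have q: "q > 0" by (simp add: q_def add_nonneg_pos)
    have "(- a / q) * a + (- a / q)\<^sup>2 * (norm f)\<^sup>2 / 2 \<le> - (a\<^sup>2 / (2 * q))"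
    proof -
      have "(- a / q)\<^sup>2 * (norm f)\<^sup>2 / 2 \<le> (- a / q)\<^sup>2 * q / 2"
        by (intro divide_right_mono mult_left_mono) (auto simp: q_def)
      also have "\<dots> = a\<^sup>2 / (2 * q)"
        using q by (simp add: field_simps power2_eq_square)
      finally show ?thesis
        by (simp add: power2_eq_square)
    qed
    with min[of "- a / q" f] have "a\<^sup>2 / (2 * q) \<le> 0" by (simp add: a_def)
    then have "a = 0" using q by (simp add: divide_le_0_iff)
    then show ?thesis by (simp add: a_def)
  qed
  then show ?thesis by blast
qed

section \<open>Distributions and their embedding\<close>

lemma distribution_space:
  assumes "distribution \<Omega> \<mu>"
  shows "space \<mu> = \<Omega>"
  using assms sets_eq_imp_space_eq[of \<mu> "restrict_space borel \<Omega>"]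
  by (simp add: distribution_def space_restrict_space)

lemma distribution_integrable:
  fixes g :: "'a::t2_space \<Rightarrow> real"
  assumes \<mu>: "distribution \<Omega> \<mu>" and g: "continuous_on \<Omega> g"
  shows "integrable \<mu> g"
proof -
  obtain C where C: "compact C" "C \<subseteq> \<Omega>" "AE x in \<mu>. x \<in> C"
    using \<mu> by (auto simp: distribution_def)
  interpret prob_space \<mu> using \<mu> by (simp add: distribution_def)
  have "bounded (g ` C)"
    by (intro compact_imp_bounded compact_continuous_image continuous_on_subset[OF g] C)
  then obtain B where "\<And>x. x \<in> C \<Longrightarrow> norm (g x) \<le> B" by (auto simp: bounded_iff)
  then have "AE x in \<mu>. norm (g x) \<le> B" using C(3) by auto
  moreover have "g \<in> borel_measurable \<mu>"
    using \<mu> borel_measurable_continuous_on_restrict[OF g] measurable_cong_sets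
    by (auto simp: distribution_def)
  ultimately show ?thesis by (rule integrable_const_bound)
qed

text \<open>Inner products separate vectors, so any representative is the one that
  \<open>THE\<close> selects. This serves both to show that distributions embed and to compute the
  embedding of a mixture.\<close>

lemma (in rkhs) embedded_eqI:
  assumes "\<And>f. (\<integral>x. val f x \<partial>\<mu>) = f \<bullet> m"
  shows "embedded val \<mu> = m"
  unfolding embedded_def
proof (rule the_equality)
  fix m' assume "\<forall>f. (\<integral>x. val f x \<partial>\<mu>) = f \<bullet> m'"
  then have "\<And>f. f \<bullet> m' = f \<bullet> m" using assms by simp
  then show "m' = m" by (metis vector_eq_rdot inner_commute)
qed (use assms in auto)

text \<open>Continuity makes every \<open>val f\<close> integrable against each distribution and
  bounded on compact sets; the existence of the embedding is derived from both.\<close>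

locale continuous_rkhs = rkhs \<Omega> val
  for \<Omega> :: "'a::t2_space set" and val :: "'h::{real_inner, complete_space} \<Rightarrow> 'a \<Rightarrow> real" +
  assumes cont: "continuous_on \<Omega> (val f)"

lemma (in continuous_rkhs) integral_eq_inner_embedded:
  assumes \<mu>: "distribution \<Omega> \<mu>"
  shows "(\<integral>x. val f x \<partial>\<mu>) = f \<bullet> embedded val \<mu>"
proof -
  obtain C where C: "compact C" "C \<subseteq> \<Omega>" "AE x in \<mu>. x \<in> C"
    using \<mu> by (auto simp: distribution_def)
  interpret prob_space \<mu> using \<mu> by (simp add: distribution_def)
  note int = distribution_integrable[OF \<mu> cont]
  have space: "space \<mu> = \<Omega>"
    by (rule distribution_space[OF \<mu>])
  have "\<exists>B. \<forall>x\<in>C. \<forall>f. norm (val f x) \<le> B * norm f"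
  proof (rule uniform_boundedness_principle)
    show "bounded ((\<lambda>x. val f x) ` C)" for f
      by (intro compact_imp_bounded compact_continuous_image continuous_on_subset[OF cont] C)
  qed (use C val_bounded_linear in auto)
  then obtain B where B: "\<And>x f. x \<in> C \<Longrightarrow> \<bar>val f x\<bar> \<le> B * norm f" by auto
  have "bounded_linear (\<lambda>f. \<integral>x. val f x \<partial>\<mu>)"
  proof (rule bounded_linear_intro)
    show "(\<integral>x. val (f + g) x \<partial>\<mu>) = (\<integral>x. val f x \<partial>\<mu>) + (\<integral>x. val g x \<partial>\<mu>)" for f g
    proof -
      have "(\<integral>x. val (f + g) x \<partial>\<mu>) = (\<integral>x. val f x + val g x \<partial>\<mu>)"
        by (intro Bochner_Integration.integral_cong)
          (simp_all add: space linear_simps[OF val_bounded_linear])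
      then show ?thesis using int by simp
    qed
    show "(\<integral>x. val (r *\<^sub>R f) x \<partial>\<mu>) = r *\<^sub>R (\<integral>x. val f x \<partial>\<mu>)" for r f
    proof -
      have "(\<integral>x. val (r *\<^sub>R f) x \<partial>\<mu>) = (\<integral>x. r * val f x \<partial>\<mu>)"
        by (intro Bochner_Integration.integral_cong)
          (simp_all add: space linear_simps[OF val_bounded_linear])
      then show ?thesis by simp
    qed
    show "norm (\<integral>x. val f x \<partial>\<mu>) \<le> norm f * B" for f
    proof -
      have "norm (\<integral>x. val f x \<partial>\<mu>) \<le> (\<integral>x. norm (val f x) \<partial>\<mu>)"
        by (rule integral_norm_bound)
      also have "\<dots> \<le> (\<integral>x. B * norm f \<partial>\<mu>)"
        using int C(3) B by (intro integral_mono_AE) auto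
      finally show ?thesis by (simp add: prob_space mult.commute)
    qed
  qed
  from Riesz_representation[OF this] obtain m where "\<And>f. (\<integral>x. val f x \<partial>\<mu>) = f \<bullet> m" by blast
  then show ?thesis using embedded_eqI by simp
qed

section \<open>Mixing a distribution with a point mass\<close>

lemma distribution_on_mixture:
  fixes \<Omega> K :: "'a::t2_space set"
  assumes \<mu>: "distribution_on \<Omega> K \<mu>" and K: "compact K" "K \<subseteq> \<Omega>" and x: "x \<in> K"
    and t: "0 \<le> t" "t \<le> 1"
  obtains \<nu> where "distribution_on \<Omega> K \<nu>"
    and "\<And>g :: 'a \<Rightarrow> real. continuous_on \<Omega> g \<Longrightarrow> (\<integral>y. g y \<partial>\<nu>) = (1 - t) * (\<integral>y. g y \<partial>\<mu>) + t * g x"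
proof -
  \<comment> \<open>The mixture is the law of a random point: toss a coin with success probability
    \<open>t\<close>, take \<open>x\<close> on success and a sample of \<mu> otherwise. A law is a
    probability measure automatically, and Fubini splits its integrals.\<close>
  let ?S = "restrict_space borel \<Omega>" and ?D = "measure_pmf (bernoulli_pmf t)"
  let ?h = "\<lambda>(b, y). if b then x else y"
  interpret M: prob_space \<mu> using \<mu> by (simp add: distribution_on_def distribution_def)
  interpret pair_prob_space ?D \<mu> ..
  have sets: "sets \<mu> = sets ?S" using \<mu> by (simp add: distribution_on_def distribution_def)
  have space: "space \<mu> = \<Omega>"
    using \<mu> by (auto simp: distribution_on_def dest: distribution_space)
  have AEK: "AE y in \<mu>. y \<in> K" using \<mu> by (simp add: distribution_on_def)
  have h[measurable]: "?h \<in> measurable (?D \<Otimes>\<^sub>M \<mu>) \<mu>"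
    using x K by (auto simp: space split_beta')
  \<comment> \<open>Compact sets are closed in a Hausdorff space, hence Borel.\<close>
  have Kset[measurable]: "K \<in> sets \<mu>"
    using K by (auto simp: sets sets_restrict_space compact_imp_closed image_iff intro!: bexI[of _ K])
  define \<nu> where "\<nu> = distr (?D \<Otimes>\<^sub>M \<mu>) \<mu> ?h"
  have "AE z in ?D \<Otimes>\<^sub>M \<mu>. ?h z \<in> K"
  proof (rule AE_pair_measure)
    have "AE y in \<mu>. ?h (b, y) \<in> K" for b
      using AEK x by (cases b) auto
    then show "AE b in ?D. AE y in \<mu>. ?h (b, y) \<in> K" by simp
  qed measurable
  then have AE\<nu>: "AE y in \<nu>. y \<in> K"
    unfolding \<nu>_def by (subst AE_distr_iff) (auto simp: Kset)
  have \<nu>: "distribution_on \<Omega> K \<nu>"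
    unfolding distribution_on_def distribution_def
    using AE\<nu> K sets by (auto simp: \<nu>_def intro!: prob_space_distr)
  show ?thesis
  proof (rule that[OF \<nu>])
    fix g :: "'a \<Rightarrow> real" assume g: "continuous_on \<Omega> g"
    have [measurable]: "g \<in> borel_measurable \<mu>"
      using borel_measurable_continuous_on_restrict[OF g] sets measurable_cong_sets by blast
    \<comment> \<open>The integrability that Fubini requires on the product is pulled back from
      \<nu>, where compact support provides it.\<close>
    have "integrable \<nu> g"
      using \<nu> g by (auto simp: distribution_on_def intro: distribution_integrable)
    then have int: "integrable (?D \<Otimes>\<^sub>M \<mu>) (\<lambda>z. g (?h z))"
      unfolding \<nu>_def by (subst (asm) integrable_distr_eq) auto
    have "(\<integral>y. g y \<partial>\<nu>) = (\<integral>z. g (?h z) \<partial>(?D \<Otimes>\<^sub>M \<mu>))"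
      unfolding \<nu>_def by (rule integral_distr) auto
    also have "\<dots> = (\<integral>b. \<integral>y. g (?h (b, y)) \<partial>\<mu> \<partial>?D)"
      by (rule integral_fst'[OF int, symmetric])
    also have "\<dots> = (1 - t) * (\<integral>y. g y \<partial>\<mu>) + t * g x"
      using t by (simp add: M.prob_space)
    finally show "(\<integral>y. g y \<partial>\<nu>) = (1 - t) * (\<integral>y. g y \<partial>\<mu>) + t * g x" .
  qed
qed

section \<open>First-order conditions at the topiary\<close>

lemma (in continuous_rkhs) topiary_margin_nonpos:
  assumes \<psi>: "continuous_on \<Omega> \<psi>"
    and K: "compact K" "K \<subseteq> \<Omega>" and top: "is_topiary \<Omega> val \<psi> K \<mu>" and x: "x \<in> K"
  shows "aesthetic_margin val \<psi> \<mu> x \<le> 0"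
proof -
  let ?m = "embedded val \<mu>"
  have \<mu>: "distribution_on \<Omega> K \<mu>"
    and max: "\<And>\<nu>. distribution_on \<Omega> K \<nu> \<Longrightarrow>
      aesthetic_objective val \<psi> \<nu> \<le> aesthetic_objective val \<psi> \<mu>"
    using top by (auto simp: is_topiary_def is_arg_max_linorder)
  then have \<mu>': "distribution \<Omega> \<mu>" by (simp add: distribution_on_def)
  note emb = integral_eq_inner_embedded[OF \<mu>']
  \<comment> \<open>Integrating the embedded function against its own measure gives its squared
    norm.\<close>
  have rate: "topiaric_rate val \<psi> \<mu> = (\<integral>y. \<psi> y \<partial>\<mu>) - ?m \<bullet> ?m"
    unfolding topiaric_rate_def
    using distribution_integrable[OF \<mu>' \<psi>] distribution_integrable[OF \<mu>' cont] emb by simp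
  have "x \<in> \<Omega>" using x K by blast
  from Riesz_representation[OF val_bounded_linear[OF this]]
  obtain k where k: "\<And>f. val f x = f \<bullet> k" by blast
  \<comment> \<open>Since \<open>k\<close> is the embedding of the point mass at \<open>x\<close>,
    this is the direction in which the mixture moves the embedded measure.\<close>
  define d where "d = k - ?m"
  have le: "aesthetic_margin val \<psi> \<mu> x \<le> t * ((norm d)\<^sup>2 / 2)" if t: "0 < t" "t < 1" for t
  proof -
    obtain \<nu> where \<nu>: "distribution_on \<Omega> K \<nu>"
      and mix: "\<And>g :: 'a \<Rightarrow> real. continuous_on \<Omega> g \<Longrightarrow>
        (\<integral>y. g y \<partial>\<nu>) = (1 - t) * (\<integral>y. g y \<partial>\<mu>) + t * g x"
      using distribution_on_mixture[OF \<mu> K x, of t] t by (metis less_imp_le)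
    have "embedded val \<nu> = ?m + t *\<^sub>R d"
      using mix[OF cont] emb k
      by (intro embedded_eqI) (simp add: d_def inner_add inner_diff_right algebra_simps)
    then have "aesthetic_objective val \<psi> \<nu> =
        (1 - t) * (\<integral>y. \<psi> y \<partial>\<mu>) + t * \<psi> x - (norm (?m + t *\<^sub>R d))\<^sup>2 / 2"
      using mix[OF \<psi>] by (simp add: aesthetic_objective_def)
    \<comment> \<open>The objective is exactly quadratic in \<open>t\<close>; by
      \<open>rate\<close>, its linear coefficient is the margin at \<open>x\<close>.\<close>
    also have "\<dots> = aesthetic_objective val \<psi> \<mu>
        + t * (aesthetic_margin val \<psi> \<mu> x - t * ((norm d)\<^sup>2 / 2))"
      unfolding aesthetic_margin_def aesthetic_objective_def rate k power2_norm_eq_inner d_def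
      by (simp add: inner_add inner_diff inner_commute field_simps)
    finally have "t * (aesthetic_margin val \<psi> \<mu> x - t * ((norm d)\<^sup>2 / 2)) \<le> 0"
      using max[OF \<nu>] by linarith
    then show ?thesis using t by (simp add: mult_le_0_iff)
  qed
  \<comment> \<open>Let \<open>t\<close> decrease to 0 in \<open>le\<close>.\<close>
  have "((\<lambda>t. t * ((norm d)\<^sup>2 / 2)) \<longlongrightarrow> 0 * ((norm d)\<^sup>2 / 2)) (at_right 0)"
    by (intro tendsto_intros)
  moreover have "\<forall>\<^sub>F t in at_right 0. aesthetic_margin val \<psi> \<mu> x \<le> t * ((norm d)\<^sup>2 / 2)"
    using eventually_at_right_real[of 0 1] by (rule eventually_mono)
      (simp_all only: greaterThanLessThan_iff le)
  ultimately show ?thesis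
    using tendsto_lowerbound by fastforce
qed

lemma (in continuous_rkhs) topiary_margin_zero_on_support:
  assumes \<psi>: "continuous_on \<Omega> \<psi>"
    and K: "compact K" "K \<subseteq> \<Omega>" and top: "is_topiary \<Omega> val \<psi> K \<mu>"
    and x: "x \<in> measure_support \<mu>"
  shows "aesthetic_margin val \<psi> \<mu> x = 0"
proof (rule ccontr)
  let ?\<iota> = "aesthetic_margin val \<psi> \<mu>"
  assume "?\<iota> x \<noteq> 0"
  have \<mu>: "distribution_on \<Omega> K \<mu>"
    using top by (auto simp: is_topiary_def is_arg_max_linorder)
  then have \<mu>': "distribution \<Omega> \<mu>" by (simp add: distribution_on_def)
  interpret prob_space \<mu> using \<mu>' by (simp add: distribution_def)
  have space: "space \<mu> = \<Omega>"
    by (rule distribution_space[OF \<mu>'])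
  have \<iota>: "continuous_on \<Omega> ?\<iota>"
    unfolding aesthetic_margin_def by (intro continuous_intros cont \<psi>)
  have int: "integrable \<mu> (\<lambda>y. \<psi> y - val (embedded val \<mu>) y)"
    using distribution_integrable[OF \<mu>' \<psi>] distribution_integrable[OF \<mu>' cont] by simp
  \<comment> \<open>The rate is the mean of the function from which the margin subtracts it.\<close>
  have "(\<integral>y. ?\<iota> y \<partial>\<mu>) = 0"
    unfolding aesthetic_margin_def using int by (simp add: topiaric_rate_def prob_space)
  moreover have "AE y in \<mu>. 0 \<le> - ?\<iota> y"
    using \<mu> topiary_margin_nonpos[OF \<psi> K top] by (auto simp: distribution_on_def)
  moreover have "integrable \<mu> ?\<iota>" by (rule distribution_integrable[OF \<mu>' \<iota>])
  ultimately have "AE y in \<mu>. ?\<iota> y = 0"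
    using integral_nonneg_eq_0_iff_AE[of \<mu> "\<lambda>y. - ?\<iota> y"] by simp
  \<comment> \<open>The nonzero set of the margin is only relatively open in \<Omega>, while
    \<open>measure_support\<close> tests ambient open sets. The extension \<open>U\<close> contains
    \<open>x\<close>, yet its trace on \<Omega> is a null set.\<close>
  obtain U where U: "open U" "U \<inter> \<Omega> = ?\<iota> -` (- {0}) \<inter> \<Omega>"
    using \<iota> unfolding continuous_on_open_invariant by (metis open_Compl closed_singleton)
  have "AE y in \<mu>. y \<notin> U \<inter> space \<mu>"
    using \<open>AE y in \<mu>. ?\<iota> y = 0\<close> U space by auto
  then have "emeasure \<mu> {y \<in> space \<mu>. y \<in> U \<inter> space \<mu>} = 0"
    by (rule emeasure_eq_0_AE)
  then have "emeasure \<mu> (U \<inter> space \<mu>) = 0"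
    by (simp add: Collect_conj_eq Int_left_commute Int_commute)
  moreover have "x \<in> U" using x U space \<open>?\<iota> x \<noteq> 0\<close> by (auto simp: measure_support_def)
  ultimately show False using x U by (auto simp: measure_support_def)
qed

theorem theorem3p3:
  fixes \<Omega> K :: "'a::t2_space set"
    and val :: "'h::{real_inner, complete_space} \<Rightarrow> 'a \<Rightarrow> real"
    and \<psi> :: "'a \<Rightarrow> real"
    and \<mu> :: "'a measure"
  assumes "rkhs \<Omega> val"
    and "\<And>f. continuous_on \<Omega> (val f)"
    and "continuous_on \<Omega> \<psi>"
    and "compact K" and "K \<subseteq> \<Omega>"
    and "is_topiary \<Omega> val \<psi> K \<mu>"
  shows "(\<forall>x \<in> measure_support \<mu>. aesthetic_margin val \<psi> \<mu> x = 0) \<and>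
         (\<forall>x \<in> K. aesthetic_margin val \<psi> \<mu> x \<le> 0)"
proof -
  interpret continuous_rkhs \<Omega> val
    using assms(1,2) by (simp add: continuous_rkhs_def continuous_rkhs_axioms_def)
  show ?thesis
    using topiary_margin_zero_on_support[OF assms(3-6)] topiary_margin_nonpos[OF assms(3-6)]
    by blast
qed

end
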